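(* Let $n>0$, and let $P_1$ and $P_2$ be $n$-leakage-resilient $(n+1)$-split circuits (possibly sharing public and secret inputs) whose sets of random inputs are disjoint. Then the parallel composition $P_1||P_2$ is also $n$-leakage-resilient.
   Context: Circuits. A program is an acyclic Boolean circuit (gates XOR, AND, OR, NOT) with secret inputs $\boldsymbol{k}=k_1,\dots,k_x$, public inputs $\boldsymbol{p}$, and random inputs $\boldsymbol{r}$. An $(n+1)$-split circuit $P$ consists of three parts. (i) An input encoder: each secret $k_i$ is replaced by $n+1$ split shares $r_{i,1},\dots,r_{i,n},\ k_i\oplus\bigoplus_{j=1}^n r_{i,j}$, where the $r_{i,j}$ are fresh random inputs; a secret may be encoded by several input encoders, each with its own fresh randoms. (ii) An observable part, computing from the shares, the public inputs and possibly additional random inputs, a number of split outputs, each being a tuple $o_{i,1},\dots,o_{i,n+1}$ of $n+1$ wires. (iii) An output decoder computing, for each split output, $\bigoplus_{j=1}^{n+1} o_{i,j}$, which is the corresponding (non-split) output of $P$. The sequence $\boldsymbol{r}$ contains all randoms, both those of the input encoders and the additional ones. Nodes. $\mathrm{nodes}(P)$ is the set of labels of the gates of $P$ excluding those internal to the input encoder and to the output decoder, but including the outputs of the input encoder and the inputs of the output decoder. Leakage resilience. For $\boldsymbol{b_p}\in\{0,1\}^{|\boldsymbol p|}$, $\boldsymbol{b_k}\in\{0,1\}^{|\boldsymbol k|}$, a sequence $\boldsymbol\alpha$ of nodes of $P$, and $\boldsymbol{b_\alpha}\in\{0,1\}^{|\boldsymbol\alpha|}$, let $\#_P(\boldsymbol{b_p},\boldsymbol{b_k},\boldsymbol\alpha,\boldsymbol{b_\alpha})$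 be the number of $\boldsymbol b\in\{0,1\}^{|\boldsymbol r|}$ such that the nodes $\boldsymbol\alpha$ take the values $\boldsymbol{b_\alpha}$ when $P$ is evaluated with $\boldsymbol p=\boldsymbol{b_p}$, $\boldsymbol k=\boldsymbol{b_k}$, $\boldsymbol r=\boldsymbol b$. Let $\mu_P(\boldsymbol{b_p},\boldsymbol{b_k},\boldsymbol\alpha)$ be the map $\boldsymbol{b_\alpha}\mapsto \#_P(\boldsymbol{b_p},\boldsymbol{b_k},\boldsymbol\alpha,\boldsymbol{b_\alpha})$. An $(n+1)$-split circuit $P$ is $n$-leakage-resilient if for all $\boldsymbol{b_p}\in\{0,1\}^{|\boldsymbol p|}$, all $\boldsymbol{b_k},\boldsymbol{b_k}'\in\{0,1\}^{|\boldsymbol k|}$ and all $\boldsymbol\alpha\in\mathrm{nodes}(P)^n$, $\mu_P(\boldsymbol{b_p},\boldsymbol{b_k},\boldsymbol\alpha)=\mu_P(\boldsymbol{b_p},\boldsymbol{b_k}',\boldsymbol\alpha)$. Parallel composition. $P_1||P_2$ is the circuit that runs $P_1$ and $P_2$ side by side: its public and secret inputs are those of $P_1$ and $P_2$ (a shared input receives the same value in both), its random inputs are those of $P_1$ together with those of $P_2$, each component keeps its own input encoder and output decoder (so a shared secret is encoded separately, with separate randoms, in each component), and its outputs are those of $P_1$ together with those of $P_2$. Its nodes are those of $P_1$ together with those of $P_2$. *)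

theory Defs
  imports "HOL-Library.FuncSet"
begin

text \<open>
  Inputs are identified by names: public inputs in \<open>'p\<close>, secret inputs in \<open>'k\<close>, random
  inputs in \<open>'r\<close>. Input encoders and gates carry labels in \<open>'e\<close> and \<open>'g\<close>.
  \<open>Share e j\<close> is the \<open>j\<close>-th output (from 0) of input encoder \<open>e\<close>. There is no wire for a
  secret, nor for the randoms of an encoder except as its shares.
\<close>

datatype ('p, 'r, 'e, 'g) wire =
    Pub 'p
  | Rnd 'r
  | Share 'e nat
  | Gate 'g

datatype 'w gate =
    Xor 'w 'w
  | And 'w 'w
  | Or 'w 'w
  | Not 'w

text \<open>
  An entry \<open>(k, rs)\<close> of \<open>encoders\<close> encodes the secret \<open>k\<close> with the fresh randoms \<open>rs\<close>. The
  observable part is given by \<open>gates\<close>, with the additional randoms \<open>extra_rands\<close>. The gates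
  internal to the encoders and to the output decoder are determined by this data and are not
  represented.
\<close>

record ('p, 'k, 'r, 'e, 'g) circuit =
  publics :: "'p set"
  secrets :: "'k set"
  encoders :: "'e \<Rightarrow> ('k \<times> 'r list) option"
  extra_rands :: "'r set"
  gates :: "'g \<Rightarrow> ('p, 'r, 'e, 'g) wire gate option"
  split_outs :: "('p, 'r, 'e, 'g) wire list list"

definition share_wires :: "('p, 'k, 'r, 'e, 'g) circuit \<Rightarrow> ('p, 'r, 'e, 'g) wire set" where
  "share_wires P = {Share e j | e k rs j. encoders P e = Some (k, rs) \<and> j \<le> length rs}"

definition obs_wires :: "('p, 'k, 'r, 'e, 'g) circuit \<Rightarrow> ('p, 'r, 'e, 'g) wire set" where
  "obs_wires P =
     Pub ` publics P \<union> Rnd ` extra_rands P \<union> share_wires P \<union> Gate ` dom (gates P)"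

definition feeds :: "('p, 'k, 'r, 'e, 'g) circuit \<Rightarrow> ('g \<times> 'g) set" where
  "feeds P = {(h, g). \<exists>G. gates P g = Some G \<and> Gate h \<in> set_gate G}"

text \<open>\<open>split_circuit n P\<close>: \<open>P\<close> is an \<open>(n+1)\<close>-split circuit.\<close>

definition split_circuit :: "nat \<Rightarrow> ('p, 'k, 'r, 'e, 'g) circuit \<Rightarrow> bool" where
  "split_circuit n P \<longleftrightarrow>
     finite (publics P) \<and> finite (secrets P) \<and> finite (extra_rands P) \<and>
     finite (dom (encoders P)) \<and> finite (dom (gates P)) \<and>
     fst ` ran (encoders P) = secrets P \<and>
     (\<forall>(k, rs) \<in> ran (encoders P).
        length rs = n \<and> distinct rs \<and> set rs \<inter> extra_rands P = {}) \<and>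
     (\<forall>e e' k rs k' rs'. encoders P e = Some (k, rs) \<longrightarrow> encoders P e' = Some (k', rs') \<longrightarrow>
        e \<noteq> e' \<longrightarrow> set rs \<inter> set rs' = {}) \<and>
     (\<forall>G \<in> ran (gates P). set_gate G \<subseteq> obs_wires P) \<and>
     acyclic (feeds P) \<and>
     (\<forall>os \<in> set (split_outs P). length os = n + 1 \<and> set os \<subseteq> obs_wires P)"

definition randoms :: "('p, 'k, 'r, 'e, 'g) circuit \<Rightarrow> 'r set" where
  "randoms P = extra_rands P \<union> (\<Union>(k, rs) \<in> ran (encoders P). set rs)"

text \<open>
  A public input or an additional random is not the output of a gate, so it is a node only where
  it is an input of the output decoder.
\<close>

definition nodes :: "('p, 'k, 'r, 'e, 'g) circuit \<Rightarrow> ('p, 'r, 'e, 'g) wire set" where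
  "nodes P = Gate ` dom (gates P) \<union> share_wires P \<union> (\<Union>os \<in> set (split_outs P). set os)"

definition xors :: "bool list \<Rightarrow> bool" where
  "xors bs = foldr (\<noteq>) bs False"

definition encode :: "bool \<Rightarrow> bool list \<Rightarrow> bool list" where
  "encode b rs = rs @ [xors (b # rs)]"

inductive wire_eval ::
  "('p, 'k, 'r, 'e, 'g) circuit \<Rightarrow> ('p \<Rightarrow> bool) \<Rightarrow> ('k \<Rightarrow> bool) \<Rightarrow> ('r \<Rightarrow> bool) \<Rightarrow>
   ('p, 'r, 'e, 'g) wire \<Rightarrow> bool \<Rightarrow> bool"
  for P bp bk br where
  Pub: "p \<in> publics P \<Longrightarrow> wire_eval P bp bk br (Pub p) (bp p)"
| Rnd: "r \<in> extra_rands P \<Longrightarrow> wire_eval P bp bk br (Rnd r) (br r)"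
| Share: "encoders P e = Some (k, rs) \<Longrightarrow> j \<le> length rs \<Longrightarrow>
    wire_eval P bp bk br (Share e j) (encode (bk k) (map br rs) ! j)"
| Xor: "gates P g = Some (Xor u v) \<Longrightarrow> wire_eval P bp bk br u a \<Longrightarrow> wire_eval P bp bk br v b \<Longrightarrow>
    wire_eval P bp bk br (Gate g) (a \<noteq> b)"
| And: "gates P g = Some (And u v) \<Longrightarrow> wire_eval P bp bk br u a \<Longrightarrow> wire_eval P bp bk br v b \<Longrightarrow>
    wire_eval P bp bk br (Gate g) (a \<and> b)"
| Or: "gates P g = Some (Or u v) \<Longrightarrow> wire_eval P bp bk br u a \<Longrightarrow> wire_eval P bp bk br v b \<Longrightarrow>
    wire_eval P bp bk br (Gate g) (a \<or> b)"
| Not: "gates P g = Some (Not u) \<Longrightarrow> wire_eval P bp bk br u a \<Longrightarrow>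
    wire_eval P bp bk br (Gate g) (\<not> a)"

definition wire_val ::
  "('p, 'k, 'r, 'e, 'g) circuit \<Rightarrow> ('p \<Rightarrow> bool) \<Rightarrow> ('k \<Rightarrow> bool) \<Rightarrow> ('r \<Rightarrow> bool) \<Rightarrow>
   ('p, 'r, 'e, 'g) wire \<Rightarrow> bool" where
  "wire_val P bp bk br w = (THE b. wire_eval P bp bk br w b)"

lemma wire_eval_unique:
  "wire_eval P bp bk br w a \<Longrightarrow> wire_eval P bp bk br w b \<Longrightarrow> a = b"
proof (induction arbitrary: b rule: wire_eval.induct)
  case (Pub p) then show ?case by (auto elim: wire_eval.cases)
next
  case (Rnd r) then show ?case by (auto elim: wire_eval.cases)
next
  case (Share e k rs j)
  from Share(3,1) show ?case by cases auto
next
  case (Xor g u v a b c)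
  from Xor.prems Xor.hyps show ?case by cases (auto dest!: Xor.IH)
next
  case (And g u v a b c)
  from And.prems And.hyps show ?case by cases (auto dest!: And.IH)
next
  case (Or g u v a b c)
  from Or.prems Or.hyps show ?case by cases (auto dest!: Or.IH)
next
  case (Not g u a c)
  from Not.prems Not.hyps show ?case by cases (auto dest!: Not.IH)
qed

text \<open>Acyclicity makes \<open>wire_val\<close> well defined on every wire of a split circuit.\<close>

lemma wire_eval_ex1:
  assumes P: "split_circuit n P" and w: "w \<in> obs_wires P"
  shows "\<exists>!b. wire_eval P bp bk br w b"
proof -
  let ?ev = "wire_eval P bp bk br"
  have "feeds P \<subseteq> dom (gates P) \<times> dom (gates P)"
  proof
    fix x assume "x \<in> feeds P"
    then obtain h g G where x: "x = (h, g)" "gates P g = Some G" "Gate h \<in> set_gate G"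
      by (auto simp: feeds_def)
    then have "Gate h \<in> obs_wires P"
      using P by (auto simp: split_circuit_def ran_def)
    then show "x \<in> dom (gates P) \<times> dom (gates P)"
      using x by (auto simp: obs_wires_def share_wires_def)
  qed
  then have "finite (feeds P)"
    using P by (meson finite_SigmaI finite_subset split_circuit_def)
  then have wf: "wf (feeds P)"
    using P by (simp add: split_circuit_def finite_acyclic_wf)
  have base: "\<exists>b. ?ev u b"
    if "u \<in> obs_wires P" "\<And>g. u = Gate g \<Longrightarrow> \<exists>b. ?ev (Gate g) b" for u
    using that by (auto simp: obs_wires_def share_wires_def intro: wire_eval.intros)
  have gate: "g \<in> dom (gates P) \<Longrightarrow> \<exists>b. ?ev (Gate g) b" for g
    using wf
  proof (induction g rule: wf_induct_rule)
    case (less g)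
    then obtain G where G: "gates P g = Some G" by auto
    have sub: "\<exists>b. ?ev u b" if u: "u \<in> set_gate G" for u
    proof (rule base)
      show uo: "u \<in> obs_wires P"
        using P G u by (auto simp: split_circuit_def ran_def)
      show "\<exists>b. ?ev (Gate h) b" if "u = Gate h" for h
      proof (rule less.IH)
        show "(h, g) \<in> feeds P" using G u that by (auto simp: feeds_def)
        show "h \<in> dom (gates P)"
          using uo that by (auto simp: obs_wires_def share_wires_def)
      qed
    qed
    show ?case
    proof (cases G)
      case (Xor u v) then show ?thesis using sub[of u] sub[of v] G by (auto intro: wire_eval.Xor)
    next
      case (And u v) then show ?thesis using sub[of u] sub[of v] G by (auto intro: wire_eval.And)
    next
      case (Or u v) then show ?thesis using sub[of u] sub[of v] G by (auto intro: wire_eval.Or)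
    next
      case (Not u) then show ?thesis using sub[of u] G by (auto intro: wire_eval.Not)
    qed
  qed
  have "\<exists>b. ?ev w b"
  proof (rule base[OF w])
    show "\<exists>b. ?ev (Gate g) b" if "w = Gate g" for g
      using gate[of g] w that by (auto simp: obs_wires_def share_wires_def)
  qed
  then show ?thesis using wire_eval_unique by metis
qed

text \<open>
  The output decoder. The outputs play no role in leakage resilience; \<open>outputs\<close> completes the
  semantics of a split circuit.
\<close>

definition outputs ::
  "('p, 'k, 'r, 'e, 'g) circuit \<Rightarrow> ('p \<Rightarrow> bool) \<Rightarrow> ('k \<Rightarrow> bool) \<Rightarrow> ('r \<Rightarrow> bool) \<Rightarrow> bool list" where
  "outputs P bp bk br = map (\<lambda>os. xors (map (wire_val P bp bk br) os)) (split_outs P)"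

text \<open>Bit strings indexed by a set of input names, as extensional functions.\<close>

abbreviation bits :: "'a set \<Rightarrow> ('a \<Rightarrow> bool) set" where
  "bits A \<equiv> A \<rightarrow>\<^sub>E (UNIV :: bool set)"

definition leak_count ::
  "('p, 'k, 'r, 'e, 'g) circuit \<Rightarrow> ('p \<Rightarrow> bool) \<Rightarrow> ('k \<Rightarrow> bool) \<Rightarrow>
   ('p, 'r, 'e, 'g) wire list \<Rightarrow> bool list \<Rightarrow> nat" where
  "leak_count P bp bk \<alpha> b\<alpha> =
     card {br \<in> bits (randoms P). map (wire_val P bp bk br) \<alpha> = b\<alpha>}"

definition leak_dist ::
  "('p, 'k, 'r, 'e, 'g) circuit \<Rightarrow> ('p \<Rightarrow> bool) \<Rightarrow> ('k \<Rightarrow> bool) \<Rightarrow>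
   ('p, 'r, 'e, 'g) wire list \<Rightarrow> bool list \<Rightarrow> nat" where
  "leak_dist P bp bk \<alpha> =
     restrict (leak_count P bp bk \<alpha>) {b\<alpha>. length b\<alpha> = length \<alpha>}"

definition leakage_resilient :: "nat \<Rightarrow> ('p, 'k, 'r, 'e, 'g) circuit \<Rightarrow> bool" where
  "leakage_resilient n P \<longleftrightarrow>
     (\<forall>bp \<in> bits (publics P). \<forall>bk \<in> bits (secrets P). \<forall>bk' \<in> bits (secrets P).
        \<forall>\<alpha>. length \<alpha> = n \<and> set \<alpha> \<subseteq> nodes P \<longrightarrow>
          leak_dist P bp bk \<alpha> = leak_dist P bp bk' \<alpha>)"

text \<open>
  Encoder and gate labels of the two components are kept apart by tagging; input names are not
  tagged, so that an input occurring in both components is shared.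
\<close>

definition parallel ::
  "('p, 'k, 'r, 'e1, 'g1) circuit \<Rightarrow> ('p, 'k, 'r, 'e2, 'g2) circuit \<Rightarrow>
   ('p, 'k, 'r, 'e1 + 'e2, 'g1 + 'g2) circuit" (infixr "\<parallel>" 65) where
  "P1 \<parallel> P2 =
     \<lparr> publics = publics P1 \<union> publics P2,
       secrets = secrets P1 \<union> secrets P2,
       encoders = case_sum (encoders P1) (encoders P2),
       extra_rands = extra_rands P1 \<union> extra_rands P2,
       gates = case_sum
         (\<lambda>g. map_option (map_gate (map_wire id id Inl Inl)) (gates P1 g))
         (\<lambda>g. map_option (map_gate (map_wire id id Inr Inr)) (gates P2 g)),
       split_outs =
         map (map (map_wire id id Inl Inl)) (split_outs P1) @
         map (map (map_wire id id Inr Inr)) (split_outs P2) \<rparr>"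

end

theory Submission
  imports Defs
begin

text \<open>
  The nodes probed in \<open>P1 \<parallel> P2\<close> are split into those of \<open>P1\<close> and those of \<open>P2\<close>, at most \<open>n\<close> on
  each side. As the components use disjoint randoms, the number of random strings that produce the
  observed values is the product of the two numbers of the components. Neither factor
  depends on the secrets: fewer than \<open>n\<close> probes can be padded to \<open>n\<close> by repeating one of
  them, and the case of no probe is trivial.
\<close>

section \<open>Sums of partial maps, pullback of cycles, and counting bit strings\<close>

lemma ran_case_sum: "ran (case_sum f g) = ran f \<union> ran g"
proof -
  have "(\<exists>a. case_sum f g a = Some x) \<longleftrightarrow> (\<exists>a. f a = Some x) \<or> (\<exists>b. g b = Some x)" for x
    by (metis old.sum.exhaust old.sum.simps(5,6))
  then show ?thesis by (auto simp: ran_def)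
qed

lemma dom_case_sum: "dom (case_sum f g) = Inl ` dom f \<union> Inr ` dom g"
proof (rule set_eqI)
  show "x \<in> dom (case_sum f g) \<longleftrightarrow> x \<in> Inl ` dom f \<union> Inr ` dom g" for x
    by (cases x) auto
qed

text \<open>A path in \<open>s\<close> that ends in the range of \<open>f\<close> never leaves that
  range when followed backwards, so it pulls back to a path in \<open>r\<close>. A cycle through
  \<open>f b\<close> would thus give a cycle through \<open>b\<close>. Applied below with
  \<open>f\<close> one of the two tags and \<open>s\<close> the feed relation of the
  composition.\<close>

lemma not_in_trancl_of_backward_closed:
  assumes "inj f" and "acyclic r"
    and closed: "\<And>x b. (x, f b) \<in> s \<Longrightarrow> \<exists>a. x = f a \<and> (a, b) \<in> r"
  shows "(f b, f b) \<notin> s\<^sup>+"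
proof
  \<comment> \<open>The endpoint \<open>f b\<close> stays fixed and the path grows at its start,
    which is the direction in which \<open>closed\<close> pulls edges back.\<close>
  have "\<exists>a. x = f a \<and> (a, b) \<in> r\<^sup>+" if "(x, f b) \<in> s\<^sup>+" for x
    using that
  proof (induction rule: converse_trancl_induct)
    case (base y)
    then show ?case using closed by blast
  next
    case (step y z)
    then show ?case using closed by (meson trancl_into_trancl2)
  qed
  \<comment> \<open>Here the start is \<open>f b\<close> too, and injectivity identifies the
    preimage \<open>a\<close> with \<open>b\<close>.\<close>
  moreover assume "(f b, f b) \<in> s\<^sup>+"
  ultimately show False
    using assms(1,2) by (auto simp: acyclic_def dest: injD)
qed

text \<open>A bit string over a disjoint union amounts to a pair of bit strings, one over each part,
  and each of the two conditions sees only its own part. The inverse of the pair of restrictions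
  glues \<open>f\<close> on \<open>A\<close> with \<open>g\<close> elsewhere.\<close>

lemma card_bits_product:
  assumes "A \<inter> B = {}"
  shows "card {f \<in> bits (A \<union> B). X (restrict f A) \<and> Y (restrict f B)} =
    card {f \<in> bits A. X f} * card {f \<in> bits B. Y f}"
proof -
  have left: "restrict (override_on g f A) A = f" if "f \<in> bits A" for f g
    using that by (auto simp: PiE_def extensional_def override_on_def fun_eq_iff)
  have right: "restrict (override_on g f A) B = g" if "g \<in> bits B" for f g
    using that assms by (auto simp: PiE_def extensional_def override_on_def fun_eq_iff)
  have glue: "override_on (restrict f B) (restrict f A) A = f" if "f \<in> bits (A \<union> B)" for f
    using that by (auto simp: PiE_def extensional_def override_on_def fun_eq_iff)
  \<comment> \<open>Off \<open>A\<close> the glued function is \<open>g\<close>, which is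
    extensional on \<open>B\<close>; this makes the result extensional on
    \<open>A \<union> B\<close>.\<close>
  have bits: "override_on g f A \<in> bits (A \<union> B)" if "g \<in> bits B" for f g
    using that by (auto simp: PiE_def extensional_def override_on_def)
  have "bij_betw (\<lambda>f. (restrict f A, restrict f B))
    {f \<in> bits (A \<union> B). X (restrict f A) \<and> Y (restrict f B)}
    ({f \<in> bits A. X f} \<times> {f \<in> bits B. Y f})"
    by (rule bij_betw_byWitness[where f' = "\<lambda>(f, g). override_on g f A"])
      (auto simp: left right glue intro: bits)
  then show ?thesis
    by (simp add: bij_betw_same_card card_cartesian_product)
qed

section \<open>Evaluating a component inside a larger circuit\<close>

lemma nodes_subset_obs_wires:
  assumes "split_circuit n P"
  shows "nodes P \<subseteq> obs_wires P"
proof -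
  have "(\<Union>os \<in> set (split_outs P). set os) \<subseteq> obs_wires P"
    using assms unfolding split_circuit_def by blast
  then show ?thesis
    unfolding nodes_def obs_wires_def by blast
qed

text \<open>Inclusion of circuits up to relabelling of encoders and gates, with input names kept.
  Both components of a parallel composition are instances, so evaluation is transferred only
  once.\<close>

definition embeds ::
  "('e \<Rightarrow> 'e') \<Rightarrow> ('g \<Rightarrow> 'g') \<Rightarrow> ('p, 'k, 'r, 'e, 'g) circuit \<Rightarrow>
   ('p, 'k, 'r, 'e', 'g') circuit \<Rightarrow> bool" where
  "embeds fe fg P Q \<longleftrightarrow>
     publics P \<subseteq> publics Q \<and> extra_rands P \<subseteq> extra_rands Q \<and>
     (\<forall>e x. encoders P e = Some x \<longrightarrow> encoders Q (fe e) = Some x) \<and>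
     (\<forall>g G. gates P g = Some G \<longrightarrow>
        gates Q (fg g) = Some (map_gate (map_wire id id fe fg) G))"

lemma embeds_parallel:
  "embeds Inl Inl P1 (P1 \<parallel> P2)" "embeds Inr Inr P2 (P1 \<parallel> P2)"
  by (simp_all add: embeds_def parallel_def)

lemma embeds_share_wires:
  assumes "embeds fe fg P Q"
  shows "map_wire id id fe fg ` share_wires P \<subseteq> share_wires Q"
  using assms by (fastforce simp: embeds_def share_wires_def)

lemma embeds_obs_wires:
  assumes "embeds fe fg P Q"
  shows "map_wire id id fe fg ` obs_wires P \<subseteq> obs_wires Q"
  using embeds_share_wires[OF assms] assms
  unfolding obs_wires_def embeds_def by fastforce

text \<open>Each rule used in a derivation for \<open>P\<close> has a counterpart for
  \<open>Q\<close> after relabelling, and its leaves read only inputs on which the two assignments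
  agree.\<close>

lemma wire_eval_embeds:
  assumes emb: "embeds fe fg P Q"
    and bp: "\<And>p. p \<in> publics P \<Longrightarrow> bp' p = bp p"
    and bk: "\<And>k. k \<in> fst ` ran (encoders P) \<Longrightarrow> bk' k = bk k"
    and br: "\<And>r. r \<in> randoms P \<Longrightarrow> br' r = br r"
    and "wire_eval P bp bk br w b"
  shows "wire_eval Q bp' bk' br' (map_wire id id fe fg w) b"
  using assms(5)
proof induction
  case (Pub p)
  then have "wire_eval Q bp' bk' br' (Pub p) (bp' p)"
    using emb by (auto simp: embeds_def intro: wire_eval.Pub)
  then show ?case using Pub bp by simp
next
  case (Rnd r)
  then have "wire_eval Q bp' bk' br' (Rnd r) (br' r)"
    using emb by (auto simp: embeds_def intro: wire_eval.Rnd)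
  then show ?case using Rnd br by (simp add: randoms_def)
next
  case (Share e k rs j)
  then have in_ran: "(k, rs) \<in> ran (encoders P)" by (auto intro: ranI)
  then have "map br' rs = map br rs"
    using br by (force simp: randoms_def)
  moreover have "bk' k = bk k"
    using bk[of k] in_ran by (metis fst_conv image_eqI)
  moreover have "encoders Q (fe e) = Some (k, rs)"
    using Share emb by (simp add: embeds_def)
  ultimately show ?case
    using wire_eval.Share[of Q "fe e" k rs j bp' bk' br'] Share(2) by (simp del: map_eq_conv)
next
  case (Xor g u v a b)
  then have "gates Q (fg g) =
      Some (Xor (map_wire id id fe fg u) (map_wire id id fe fg v))"
    using emb by (simp add: embeds_def)
  from wire_eval.Xor[OF this Xor.IH] show ?case by simp
next
  case (And g u v a b)
  then have "gates Q (fg g) =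
      Some (And (map_wire id id fe fg u) (map_wire id id fe fg v))"
    using emb by (simp add: embeds_def)
  from wire_eval.And[OF this And.IH] show ?case by simp
next
  case (Or g u v a b)
  then have "gates Q (fg g) =
      Some (Or (map_wire id id fe fg u) (map_wire id id fe fg v))"
    using emb by (simp add: embeds_def)
  from wire_eval.Or[OF this Or.IH] show ?case by simp
next
  case (Not g u a)
  then have "gates Q (fg g) = Some (Not (map_wire id id fe fg u))"
    using emb by (simp add: embeds_def)
  from wire_eval.Not[OF this Not.IH] show ?case by simp
qed

lemma wire_val_eqI:
  assumes "wire_eval P bp bk br w b"
  shows "wire_val P bp bk br w = b"
  unfolding wire_val_def using assms by (rule the_equality) (rule wire_eval_unique[OF _ assms])

text \<open>A derivation of some value exists in the split circuit \<open>P\<close>. It carries over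
  to \<open>Q\<close>, and uniqueness of values then settles both sides. Restricting the inputs
  yields extensional bit strings over the names of \<open>P\<close>, the form in which resilience of
  \<open>P\<close> can be applied.\<close>

lemma wire_val_embeds:
  assumes "embeds fe fg P Q" and P: "split_circuit n P" and w: "w \<in> nodes P"
  shows "wire_val Q bp bk br (map_wire id id fe fg w) =
    wire_val P (restrict bp (publics P)) (restrict bk (secrets P)) (restrict br (randoms P)) w"
proof -
  let ?ev = "wire_eval P (restrict bp (publics P)) (restrict bk (secrets P))
    (restrict br (randoms P)) w"
  have "\<exists>!b. ?ev b"
    by (rule wire_eval_ex1[OF P subsetD[OF nodes_subset_obs_wires[OF P] w]])
  then obtain b where b: "?ev b"
    by (elim ex1E)
  have sec: "fst ` ran (encoders P) = secrets P"
    using P unfolding split_circuit_def by (elim conjE)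
  have "wire_eval Q bp bk br (map_wire id id fe fg w) b"
    by (rule wire_eval_embeds[OF assms(1) _ _ _ b]) (simp_all add: sec)
  then show ?thesis
    using b by (simp add: wire_val_eqI)
qed

section \<open>Resilience against at most \<open>n\<close> probes\<close>

text \<open>Resilience speaks of exactly \<open>n\<close> probes, while a component receives only
  some of them. Repeating a probe together with its prescribed value leaves the counted set
  unchanged; without probes both sides count all random strings. Indexing by a set lets positions in
  the list of all probes serve directly as indices.\<close>

lemma leakage_resilient_le:
  assumes P: "leakage_resilient n P"
    and bp: "bp \<in> bits (publics P)" and bk: "bk \<in> bits (secrets P)" "bk' \<in> bits (secrets P)"
    and I: "finite I" "card I \<le> n" and w: "\<And>i. i \<in> I \<Longrightarrow> w i \<in> nodes P"
  shows "card {br \<in> bits (randoms P). \<forall>i\<in>I. wire_val P bp bk br (w i) = b i} =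
    card {br \<in> bits (randoms P). \<forall>i\<in>I. wire_val P bp bk' br (w i) = b i}"
proof (cases "I = {}")
  case False
  obtain xs where xs: "set xs = I" "distinct xs"
    using I finite_distinct_list by blast
  then have "length xs \<le> n"
    using I distinct_card by metis
  \<comment> \<open>The padding repeats an index, hence wire and value alike, so the repeated
    conditions are consistent.\<close>
  define ys where "ys = xs @ replicate (n - length xs) (hd xs)"
  have "xs \<noteq> []" using False xs by auto
  then have ys: "set ys = I" "length ys = n"
    using xs \<open>length xs \<le> n\<close> by (auto simp: ys_def)
  then have "leak_dist P bp bk (map w ys) = leak_dist P bp bk' (map w ys)"
    using P[unfolded leakage_resilient_def, rule_format, OF bp bk, of "map w ys"] w by auto
  \<comment> \<open>The list \<open>map b ys\<close> has the length to which
    \<open>leak_dist\<close> is restricted, so the restriction disappears here.\<close>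
  from fun_cong[OF this, of "map b ys"]
  have "leak_count P bp bk (map w ys) (map b ys) = leak_count P bp bk' (map w ys) (map b ys)"
    by (simp add: leak_dist_def)
  moreover have "map (wire_val P bp c br) (map w ys) = map b ys \<longleftrightarrow>
      (\<forall>i\<in>I. wire_val P bp c br (w i) = b i)" for c br
    using ys by auto
  ultimately show ?thesis by (simp only: leak_count_def)
qed simp

section \<open>Structure of the parallel composition\<close>

lemma encoder_subset_randoms: "encoders P e = Some (k, rs) \<Longrightarrow> set rs \<subseteq> randoms P"
  by (force intro: ranI simp: randoms_def)

lemma randoms_parallel: "randoms (P1 \<parallel> P2) = randoms P1 \<union> randoms P2"
  by (auto simp: randoms_def parallel_def ran_case_sum)

text \<open>Attributes every probe to a component. Shares and gates reveal theirs by the tag; an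
  untagged input wire is attributed through the split output in which it occurs.\<close>

lemma nodes_parallel:
  "nodes (P1 \<parallel> P2) \<subseteq>
     map_wire id id Inl Inl ` nodes P1 \<union> map_wire id id Inr Inr ` nodes P2"
proof -
  have shares: "share_wires (P1 \<parallel> P2) \<subseteq>
      map_wire id id Inl Inl ` share_wires P1 \<union> map_wire id id Inr Inr ` share_wires P2"
  proof
    fix w assume "w \<in> share_wires (P1 \<parallel> P2)"
    then obtain e k rs j where w: "w = Share e j" "encoders (P1 \<parallel> P2) e = Some (k, rs)"
      "j \<le> length rs"
      by (auto simp: share_wires_def)
    show "w \<in> map_wire id id Inl Inl ` share_wires P1 \<union> map_wire id id Inr Inr ` share_wires P2"
    proof (cases e)
      case (Inl a)
      then have "Share a j \<in> share_wires P1" "w = map_wire id id Inl Inl (Share a j)"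
        using w by (auto simp: share_wires_def parallel_def)
      then show ?thesis by blast
    next
      case (Inr a)
      then have "Share a j \<in> share_wires P2" "w = map_wire id id Inr Inr (Share a j)"
        using w by (auto simp: share_wires_def parallel_def)
      then show ?thesis by blast
    qed
  qed
  have gates: "Gate ` dom (gates (P1 \<parallel> P2)) \<subseteq>
      map_wire id id Inl Inl ` Gate ` dom (gates P1) \<union>
      map_wire id id Inr Inr ` Gate ` dom (gates P2)"
    by (auto simp: parallel_def dom_case_sum image_image)
  have outs: "(\<Union>os \<in> set (split_outs (P1 \<parallel> P2)). set os) =
      map_wire id id Inl Inl ` (\<Union>os \<in> set (split_outs P1). set os) \<union>
      map_wire id id Inr Inr ` (\<Union>os \<in> set (split_outs P2). set os)"
    by (auto simp: parallel_def)
  show ?thesis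
    unfolding nodes_def
    by (rule order_trans[OF Un_mono[OF Un_mono[OF gates shares] equalityD1[OF outs]]])
      (simp only: image_Un Un_ac subset_refl)
qed

lemma Gate_eq_map_wire_iff:
  "Gate x = map_wire fp fr fe fg w \<longleftrightarrow> (\<exists>h. w = Gate h \<and> x = fg h)"
  by (cases w) auto

lemma feeds_parallel_Inl:
  "(x, Inl g) \<in> feeds (P1 \<parallel> P2) \<Longrightarrow> \<exists>h. x = Inl h \<and> (h, g) \<in> feeds P1"
  by (auto simp: feeds_def parallel_def gate.set_map Gate_eq_map_wire_iff)

lemma feeds_parallel_Inr:
  "(x, Inr g) \<in> feeds (P1 \<parallel> P2) \<Longrightarrow> \<exists>h. x = Inr h \<and> (h, g) \<in> feeds P2"
  by (auto simp: feeds_def parallel_def gate.set_map Gate_eq_map_wire_iff)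

text \<open>Every gate lies in one of the two tagged copies, and a gate is fed only by gates of its
  own copy, so no cycle can run through it.\<close>

lemma acyclic_feeds_parallel:
  assumes "acyclic (feeds P1)" and "acyclic (feeds P2)"
  shows "acyclic (feeds (P1 \<parallel> P2))"
  unfolding acyclic_def
proof
  show "(x, x) \<notin> (feeds (P1 \<parallel> P2))\<^sup>+" for x
  proof (cases x)
    case (Inl g)
    then show ?thesis
      using not_in_trancl_of_backward_closed[OF inj_Inl assms(1) feeds_parallel_Inl] by simp
  next
    case (Inr g)
    then show ?thesis
      using not_in_trancl_of_backward_closed[OF inj_Inr assms(2) feeds_parallel_Inr] by simp
  qed
qed

text \<open>Disjointness of the randoms keeps the encoders of one component fresh with respect to
  the other. The remaining conditions are inherited from the components, with wires carried along by
  the embeddings.\<close>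

lemma split_circuit_parallel:
  assumes P1: "split_circuit n P1" and P2: "split_circuit n P2"
    and disj: "randoms P1 \<inter> randoms P2 = {}"
  shows "split_circuit n (P1 \<parallel> P2)"
proof -
  let ?Q = "P1 \<parallel> P2"
  note emb = embeds_obs_wires[OF embeds_parallel(1)[of P1 P2]]
    embeds_obs_wires[OF embeds_parallel(2)[of P2 P1]]
  have ran_enc: "ran (encoders ?Q) = ran (encoders P1) \<union> ran (encoders P2)"
    by (simp add: parallel_def ran_case_sum)
  have fin: "finite (publics ?Q)" "finite (secrets ?Q)" "finite (extra_rands ?Q)"
      "finite (dom (encoders ?Q))" "finite (dom (gates ?Q))"
    using P1 P2 by (simp_all add: split_circuit_def parallel_def dom_case_sum dom_map_option
      comp_def)
  have sec: "fst ` ran (encoders ?Q) = secrets ?Q"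
    using P1 P2 unfolding ran_enc image_Un by (simp add: split_circuit_def parallel_def)
  have extra: "extra_rands P1 \<subseteq> randoms P1" "extra_rands P2 \<subseteq> randoms P2"
    by (auto simp: randoms_def)
  have enc: "length rs = n \<and> distinct rs \<and> set rs \<inter> extra_rands ?Q = {}"
    if k: "(k, rs) \<in> ran (encoders ?Q)" for k rs
  proof -
    consider "(k, rs) \<in> ran (encoders P1)" | "(k, rs) \<in> ran (encoders P2)"
      using k unfolding ran_enc by blast
    then show ?thesis
    proof cases
      case 1
      then have "set rs \<subseteq> randoms P1" by (auto simp: ran_def dest: encoder_subset_randoms)
      moreover have "length rs = n \<and> distinct rs \<and> set rs \<inter> extra_rands P1 = {}"
        using 1 P1 unfolding split_circuit_def by blast
      ultimately show ?thesis using extra disj by (auto simp: parallel_def)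
    next
      case 2
      then have "set rs \<subseteq> randoms P2" by (auto simp: ran_def dest: encoder_subset_randoms)
      moreover have "length rs = n \<and> distinct rs \<and> set rs \<inter> extra_rands P2 = {}"
        using 2 P2 unfolding split_circuit_def by blast
      ultimately show ?thesis using extra disj by (auto simp: parallel_def)
    qed
  qed
  have sep: "set rs \<inter> set rs' = {}"
    if "encoders ?Q e = Some (k, rs)" "encoders ?Q e' = Some (k', rs')" "e \<noteq> e'" for e e' k rs k' rs'
  proof (cases e; cases e')
    fix a a' assume "e = Inl a" "e' = Inl a'"
    then show ?thesis using that P1 by (simp add: split_circuit_def parallel_def)
  next
    \<comment> \<open>For encoders of different components, freshness comes from \<open>disj\<close>
      instead of the split property of one component.\<close>
    fix a a' assume "e = Inl a" "e' = Inr a'"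
    then have "set rs \<subseteq> randoms P1" "set rs' \<subseteq> randoms P2"
      using that by (simp_all add: parallel_def encoder_subset_randoms)
    then show ?thesis using disj by blast
  next
    fix a a' assume "e = Inr a" "e' = Inl a'"
    then have "set rs \<subseteq> randoms P2" "set rs' \<subseteq> randoms P1"
      using that by (simp_all add: parallel_def encoder_subset_randoms)
    then show ?thesis using disj by blast
  next
    fix a a' assume "e = Inr a" "e' = Inr a'"
    then show ?thesis using that P2 by (simp add: split_circuit_def parallel_def)
  qed
  have gat: "set_gate G \<subseteq> obs_wires ?Q" if G: "G \<in> ran (gates ?Q)" for G
  proof -
    consider g H where "gates P1 g = Some H" "G = map_gate (map_wire id id Inl Inl) H"
      | g H where "gates P2 g = Some H" "G = map_gate (map_wire id id Inr Inr) H"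
      using G by (auto simp: parallel_def ran_case_sum) (auto simp: ran_def)
    then show ?thesis
    proof cases
      case 1
      then have "set_gate H \<subseteq> obs_wires P1"
        using P1 by (auto simp: split_circuit_def ran_def)
      then show ?thesis using 1 emb(1) by (auto simp: gate.set_map)
    next
      case 2
      then have "set_gate H \<subseteq> obs_wires P2"
        using P2 by (auto simp: split_circuit_def ran_def)
      then show ?thesis using 2 emb(2) by (auto simp: gate.set_map)
    qed
  qed
  have acyc: "acyclic (feeds ?Q)"
    using P1 P2 by (intro acyclic_feeds_parallel) (simp_all add: split_circuit_def)
  have outs: "length os = n + 1 \<and> set os \<subseteq> obs_wires ?Q"
    if os: "os \<in> set (split_outs ?Q)" for os
  proof -
    consider os1 where "os1 \<in> set (split_outs P1)" "os = map (map_wire id id Inl Inl) os1"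
      | os2 where "os2 \<in> set (split_outs P2)" "os = map (map_wire id id Inr Inr) os2"
      using os by (auto simp: parallel_def)
    then show ?thesis
    proof cases
      case 1
      then have "length os1 = n + 1 \<and> set os1 \<subseteq> obs_wires P1"
        using P1 by (simp add: split_circuit_def)
      then show ?thesis using 1 emb(1) by auto
    next
      case 2
      then have "length os2 = n + 1 \<and> set os2 \<subseteq> obs_wires P2"
        using P2 by (simp add: split_circuit_def)
      then show ?thesis using 2 emb(2) by auto
    qed
  qed
  have "\<forall>(k, rs) \<in> ran (encoders ?Q).
      length rs = n \<and> distinct rs \<and> set rs \<inter> extra_rands ?Q = {}"
    using enc by blast
  moreover have "\<forall>e e' k rs k' rs'. encoders ?Q e = Some (k, rs) \<longrightarrow>
      encoders ?Q e' = Some (k', rs') \<longrightarrow> e \<noteq> e' \<longrightarrow> set rs \<inter> set rs' = {}"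
    using sep by blast
  moreover have "\<forall>G \<in> ran (gates ?Q). set_gate G \<subseteq> obs_wires ?Q"
    using gat by blast
  moreover have "\<forall>os \<in> set (split_outs ?Q). length os = n + 1 \<and> set os \<subseteq> obs_wires ?Q"
    using outs by blast
  ultimately show ?thesis
    unfolding split_circuit_def by (intro conjI fin sec acyc)
qed

section \<open>Factorization of the leakage count and the conclusion\<close>

text \<open>A probe in one component depends on the random string only through its restriction to
  the randoms of that component, so the joint event is a product event. Shared inputs enter both
  factors as restrictions of the same \<open>bp\<close> and \<open>bk\<close>.\<close>

lemma leak_count_parallel:
  assumes P1: "split_circuit n P1" and P2: "split_circuit n P2"
    and disj: "randoms P1 \<inter> randoms P2 = {}"
    and len: "length b\<alpha> = length \<alpha>"
    and split: "I1 \<union> I2 = {..<length \<alpha>}"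
    and w1: "\<forall>i \<in> I1. w1 i \<in> nodes P1 \<and> \<alpha> ! i = map_wire id id Inl Inl (w1 i)"
    and w2: "\<forall>i \<in> I2. w2 i \<in> nodes P2 \<and> \<alpha> ! i = map_wire id id Inr Inr (w2 i)"
  shows "leak_count (P1 \<parallel> P2) bp bk \<alpha> b\<alpha> =
    card {br \<in> bits (randoms P1). \<forall>i\<in>I1.
      wire_val P1 (restrict bp (publics P1)) (restrict bk (secrets P1)) br (w1 i) = b\<alpha> ! i} *
    card {br \<in> bits (randoms P2). \<forall>i\<in>I2.
      wire_val P2 (restrict bp (publics P2)) (restrict bk (secrets P2)) br (w2 i) = b\<alpha> ! i}"
proof -
  have v1: "wire_val (P1 \<parallel> P2) bp bk br (\<alpha> ! i) = wire_val P1 (restrict bp (publics P1))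
      (restrict bk (secrets P1)) (restrict br (randoms P1)) (w1 i)" if "i \<in> I1" for br i
    using w1 that wire_val_embeds[OF embeds_parallel(1) P1] by metis
  have v2: "wire_val (P1 \<parallel> P2) bp bk br (\<alpha> ! i) = wire_val P2 (restrict bp (publics P2))
      (restrict bk (secrets P2)) (restrict br (randoms P2)) (w2 i)" if "i \<in> I2" for br i
    using w2 that wire_val_embeds[OF embeds_parallel(2) P2] by metis
  have "map (wire_val (P1 \<parallel> P2) bp bk br) \<alpha> = b\<alpha> \<longleftrightarrow>
      (\<forall>i \<in> I1 \<union> I2. wire_val (P1 \<parallel> P2) bp bk br (\<alpha> ! i) = b\<alpha> ! i)" for br
    unfolding split using len by (auto simp: list_eq_iff_nth_eq)
  then show ?thesis
    \<comment> \<open>The product formula is read from right to left: the two counts merge into one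
      over the joint random strings.\<close>
    unfolding leak_count_def randoms_parallel card_bits_product[OF disj, symmetric]
    by (simp add: v1 v2 ball_Un)
qed

theorem theorem2:
  fixes P1 :: "('p, 'k, 'r, 'e1, 'g1) circuit"
    and P2 :: "('p, 'k, 'r, 'e2, 'g2) circuit"
    and n :: nat
  assumes "n > 0"
    and "split_circuit n P1" and "leakage_resilient n P1"
    and "split_circuit n P2" and "leakage_resilient n P2"
    and "randoms P1 \<inter> randoms P2 = {}"
  shows "split_circuit n (P1 \<parallel> P2) \<and> leakage_resilient n (P1 \<parallel> P2)"
proof
  let ?Q = "P1 \<parallel> P2"
  show "split_circuit n ?Q"
    using assms by (intro split_circuit_parallel)
  show "leakage_resilient n ?Q"
    unfolding leakage_resilient_def
  proof (intro ballI allI impI)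
    fix bp bk bk' and \<alpha> :: "('p, 'r, 'e1 + 'e2, 'g1 + 'g2) wire list"
    assume \<alpha>: "length \<alpha> = n \<and> set \<alpha> \<subseteq> nodes ?Q"
    \<comment> \<open>A public input that feeds both output decoders is a node of either component.
      Taking \<open>I2\<close> as the complement of \<open>I1\<close> assigns such a probe to
      \<open>P1\<close>.\<close>
    define I1 where "I1 = {i. i < n \<and> \<alpha> ! i \<in> map_wire id id Inl Inl ` nodes P1}"
    define I2 where "I2 = {..<n} - I1"
    have I: "I1 \<union> I2 = {..<length \<alpha>}" "finite I1" "finite I2"
      using \<alpha> by (auto simp: I1_def I2_def)
    have "I1 \<subseteq> {..<n}" "I2 \<subseteq> {..<n}"
      by (auto simp: I1_def I2_def)
    then have card: "card I1 \<le> n" "card I2 \<le> n"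
      using card_mono[OF finite_lessThan] by (metis card_lessThan)+
    have "\<forall>i\<in>I1. \<exists>w. w \<in> nodes P1 \<and> \<alpha> ! i = map_wire id id Inl Inl w"
      by (auto simp: I1_def)
    then obtain w1 where w1:
      "\<forall>i\<in>I1. w1 i \<in> nodes P1 \<and> \<alpha> ! i = map_wire id id Inl Inl (w1 i)"
      by metis
    have "\<forall>i\<in>I2. \<exists>w. w \<in> nodes P2 \<and> \<alpha> ! i = map_wire id id Inr Inr w"
    proof
      fix i assume "i \<in> I2"
      then have "\<alpha> ! i \<in> nodes ?Q" "\<alpha> ! i \<notin> map_wire id id Inl Inl ` nodes P1"
        using \<alpha> by (auto simp: I1_def I2_def)
      then show "\<exists>w. w \<in> nodes P2 \<and> \<alpha> ! i = map_wire id id Inr Inr w"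
        using nodes_parallel[of P1 P2] by blast
    qed
    then obtain w2 where w2:
      "\<forall>i\<in>I2. w2 i \<in> nodes P2 \<and> \<alpha> ! i = map_wire id id Inr Inr (w2 i)"
      by metis
    \<comment> \<open>The assignment of probes to components does not depend on the secrets, so both
      counts factor along the same \<open>I1\<close> and \<open>I2\<close>, and the factors agree
      one by one.\<close>
    have "leak_count ?Q bp bk \<alpha> b\<alpha> = leak_count ?Q bp bk' \<alpha> b\<alpha>" if "length b\<alpha> = length \<alpha>" for b\<alpha>
      unfolding leak_count_parallel[OF assms(2,4,6) that I(1) w1 w2]
      by (intro arg_cong2[where f = "(*)"]
          leakage_resilient_le[OF assms(3) _ _ _ I(2) card(1)]
          leakage_resilient_le[OF assms(5) _ _ _ I(3) card(2)])
        (use w1 w2 in simp_all)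
    then show "leak_dist ?Q bp bk \<alpha> = leak_dist ?Q bp bk' \<alpha>"
      unfolding leak_dist_def by (intro restrict_ext) simp
  qed
qed

end
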